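(* Let $\lambda$ be an infinite cardinal. Every non-trivial congruence on the semigroup $\mathscr{I}^{\mathrm{cf}}_\lambda$ of injective partial cofinite selfmaps of $\lambda$ is a group congruence.
   Context: The infinite cardinal $\lambda$ is identified with a set of cardinality $\lambda$. $\mathscr{I}^{\mathrm{cf}}_\lambda$ is the set of all injective partial maps $\alpha\colon\lambda\rightharpoonup\lambda$ such that $\lambda\setminus\operatorname{dom}\alpha$ and $\lambda\setminus\operatorname{ran}\alpha$ are both finite. Maps are written on the right and composed left to right: $x(\alpha\beta)=(x\alpha)\beta$ for $x\in\operatorname{dom}(\alpha\beta)=\{y\in\operatorname{dom}\alpha\mid y\alpha\in\operatorname{dom}\beta\}$. With this operation $\mathscr{I}^{\mathrm{cf}}_\lambda$ is an inverse monoid. A congruence $\mathfrak{C}$ on a semigroup $S$ is non-trivial if it is distinct from the universal congruence and from the identity congruence on $S$; it is a group congruence if the quotient semigroup $S/\mathfrak{C}$ is a group. *)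

theory Defs
  imports "HOL-Algebra.Group"
begin

text \<open>Maps are written on the right in the source, so the product \<open>\<alpha> \<beta>\<close> (first \<open>\<alpha>\<close>, then \<open>\<beta>\<close>)
  is \<open>\<beta> \<circ>\<^sub>m \<alpha>\<close>.\<close>

definition cofinite_partial_injections :: "'a set \<Rightarrow> ('a \<rightharpoonup> 'a) monoid" where
  "cofinite_partial_injections L =
    \<lparr>carrier = {\<alpha>. dom \<alpha> \<subseteq> L \<and> ran \<alpha> \<subseteq> L \<and> inj_on \<alpha> (dom \<alpha>) \<and>
                    finite (L - dom \<alpha>) \<and> finite (L - ran \<alpha>)},
     monoid.mult = (\<lambda>\<alpha> \<beta>. \<beta> \<circ>\<^sub>m \<alpha>),
     one = (\<lambda>x. if x \<in> L then Some x else None)\<rparr>"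

lemma monoid_cofinite_partial_injections: "monoid (cofinite_partial_injections L)"
proof (rule monoidI)
  let ?S = "cofinite_partial_injections L"
  fix \<alpha> \<beta> assume a: "\<alpha> \<in> carrier ?S" and b: "\<beta> \<in> carrier ?S"
  have d: "L - dom (\<beta> \<circ>\<^sub>m \<alpha>) \<subseteq> (L - dom \<alpha>) \<union> {x \<in> dom \<alpha>. \<alpha> x \<in> Some ` (L - dom \<beta>)}"
    using a by (force simp: cofinite_partial_injections_def ran_def map_comp_def split: option.splits)
  have r: "L - ran (\<beta> \<circ>\<^sub>m \<alpha>) \<subseteq> (L - ran \<beta>) \<union> (the \<circ> \<beta>) ` (L - ran \<alpha>)"
  proof
    fix z assume z: "z \<in> L - ran (\<beta> \<circ>\<^sub>m \<alpha>)"
    show "z \<in> (L - ran \<beta>) \<union> (the \<circ> \<beta>) ` (L - ran \<alpha>)"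
    proof (cases "z \<in> ran \<beta>")
      case True
      then obtain y where y: "\<beta> y = Some z" by (auto simp: ran_def)
      have "y \<in> L" using b y by (auto simp: cofinite_partial_injections_def)
      moreover have "y \<notin> ran \<alpha>" using z y by (auto simp: ran_def map_comp_def split: option.splits)
      ultimately show ?thesis using y by force
    qed (use z in auto)
  qed
  have "finite {x \<in> dom \<alpha>. \<alpha> x \<in> Some ` (L - dom \<beta>)}"
    using a b by (auto simp: cofinite_partial_injections_def intro!: finite_inverse_image_gen)
  then have "finite (L - dom (\<beta> \<circ>\<^sub>m \<alpha>))"
    using a finite_subset[OF d] by (auto simp: cofinite_partial_injections_def)
  moreover have "finite (L - ran (\<beta> \<circ>\<^sub>m \<alpha>))"
    using a b finite_subset[OF r] by (auto simp: cofinite_partial_injections_def)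
  moreover have "inj_on (\<beta> \<circ>\<^sub>m \<alpha>) (dom (\<beta> \<circ>\<^sub>m \<alpha>))"
    using a b unfolding cofinite_partial_injections_def
    by (auto simp: inj_on_def map_comp_Some_iff dom_def)
  moreover have "dom (\<beta> \<circ>\<^sub>m \<alpha>) \<subseteq> L" "ran (\<beta> \<circ>\<^sub>m \<alpha>) \<subseteq> L"
    using a b by (auto simp: cofinite_partial_injections_def map_comp_Some_iff ran_def dom_def)
  ultimately show "\<alpha> \<otimes>\<^bsub>?S\<^esub> \<beta> \<in> carrier ?S"
    by (simp add: cofinite_partial_injections_def)
next
  let ?S = "cofinite_partial_injections L"
  have "ran (\<lambda>x. if x \<in> L then Some x else None) = L" by (auto simp: ran_def)
  then show "\<one>\<^bsub>?S\<^esub> \<in> carrier ?S"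
    by (auto simp: cofinite_partial_injections_def inj_on_def dom_def)
  fix \<alpha> assume "\<alpha> \<in> carrier ?S"
  then have "dom \<alpha> \<subseteq> L" "ran \<alpha> \<subseteq> L" by (auto simp: cofinite_partial_injections_def)
  then show "\<one>\<^bsub>?S\<^esub> \<otimes>\<^bsub>?S\<^esub> \<alpha> = \<alpha>" "\<alpha> \<otimes>\<^bsub>?S\<^esub> \<one>\<^bsub>?S\<^esub> = \<alpha>"
    by (force simp: cofinite_partial_injections_def map_comp_def fun_eq_iff ran_def
          split: option.splits)+
qed (simp add: cofinite_partial_injections_def map_comp_def fun_eq_iff split: option.splits)

definition semigroup_congruence :: "('a, 'b) monoid_scheme \<Rightarrow> ('a \<times> 'a) set \<Rightarrow> bool" where
  "semigroup_congruence S C \<longleftrightarrow>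
    equiv (carrier S) C \<and>
    (\<forall>a b c d. (a, b) \<in> C \<longrightarrow> (c, d) \<in> C \<longrightarrow> (a \<otimes>\<^bsub>S\<^esub> c, b \<otimes>\<^bsub>S\<^esub> d) \<in> C)"

definition nontrivial_congruence :: "('a, 'b) monoid_scheme \<Rightarrow> ('a \<times> 'a) set \<Rightarrow> bool" where
  "nontrivial_congruence S C \<longleftrightarrow>
    semigroup_congruence S C \<and> C \<noteq> carrier S \<times> carrier S \<and> C \<noteq> Id_on (carrier S)"

text \<open>For a congruence \<open>C\<close>, the union in the product below is the single class of any
  \<open>a \<otimes> b\<close> with \<open>a \<in> A\<close>, \<open>b \<in> B\<close>.\<close>

definition quotient_monoid :: "('a, 'b) monoid_scheme \<Rightarrow> ('a \<times> 'a) set \<Rightarrow> 'a set monoid" where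
  "quotient_monoid S C =
    \<lparr>carrier = carrier S // C,
     monoid.mult = (\<lambda>A B. \<Union>a\<in>A. \<Union>b\<in>B. C `` {a \<otimes>\<^bsub>S\<^esub> b}),
     one = C `` {\<one>\<^bsub>S\<^esub>}\<rparr>"

text \<open>When \<open>S\<close> is a monoid, the class of \<open>\<one>\<close> is the only possible identity of the
  quotient semigroup, so fixing it as the unit does not change when the quotient is a group.\<close>

definition group_congruence :: "('a, 'b) monoid_scheme \<Rightarrow> ('a \<times> 'a) set \<Rightarrow> bool" where
  "group_congruence S C \<longleftrightarrow> semigroup_congruence S C \<and> group (quotient_monoid S C)"

end

theory Submission
  imports Defs
begin

text \<open>
  The idempotents of the monoid are the partial identities \<open>Some |` A\<close> on cofinite sets
  \<open>A \<subseteq> L\<close>. Every element \<open>\<alpha>\<close> has a partial inverse whose products with \<open>\<alpha>\<close> are idempotents, so a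
  congruence is a group congruence as soon as it identifies every idempotent with the unit.

  For a congruence other than the identity this happens for the following reason. Take congruent
  elements \<open>\<alpha> \<noteq> \<beta>\<close>. After exchanging them or deleting one point from the codomain of both, if
  necessary, there is a point \<open>x \<in> dom \<alpha> - dom \<beta>\<close>. Since \<open>L\<close> is infinite, removing finitely many points does not change its
  cardinality; hence for any \<open>z \<in> L\<close> there is an element \<open>\<sigma>\<close> mapping \<open>L\<close> bijectively onto
  \<open>dom \<alpha>\<close> with \<open>z \<mapsto> x\<close>. With \<open>\<tau>\<close> the partial inverse of \<open>\<sigma> \<alpha>\<close>, the element \<open>\<sigma> \<alpha> \<tau>\<close> is the unit,
  whereas \<open>\<gamma> = \<sigma> \<beta> \<tau>\<close> is undefined at \<open>z\<close>. So \<open>\<gamma>\<close> is congruent to the unit, and it absorbs the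
  partial identity on \<open>L - {z}\<close> from the left, which is therefore congruent to the unit as well
  (lemma \<open>point_deletion_congruent_one\<close>). Here \<open>z\<close> was arbitrary, and every idempotent is a finite
  product of such partial identities.
\<close>

section \<open>Congruences on monoids\<close>

lemma semigroup_congruenceD:
  assumes "semigroup_congruence S C"
  shows "equiv (carrier S) C"
    and "\<And>a b. (a, b) \<in> C \<Longrightarrow> a \<in> carrier S \<and> b \<in> carrier S"
    and "\<And>a. a \<in> carrier S \<Longrightarrow> (a, a) \<in> C"
    and "\<And>a b. (a, b) \<in> C \<Longrightarrow> (b, a) \<in> C"
    and "\<And>a b c. (a, b) \<in> C \<Longrightarrow> (b, c) \<in> C \<Longrightarrow> (a, c) \<in> C"
    and "\<And>a b c d. (a, b) \<in> C \<Longrightarrow> (c, d) \<in> C \<Longrightarrow> (a \<otimes>\<^bsub>S\<^esub> c, b \<otimes>\<^bsub>S\<^esub> d) \<in> C"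
proof -
  show e: "equiv (carrier S) C"
    using assms by (simp add: semigroup_congruence_def)
  show "(a, b) \<in> C \<Longrightarrow> a \<in> carrier S \<and> b \<in> carrier S" for a b
    using equiv_type[OF e] by blast
  show "a \<in> carrier S \<Longrightarrow> (a, a) \<in> C" for a
    using e by (auto simp: equiv_def refl_on_def)
  show "(a, b) \<in> C \<Longrightarrow> (b, a) \<in> C" for a b
    using e by (auto simp: equiv_def sym_def)
  show "(a, b) \<in> C \<Longrightarrow> (b, c) \<in> C \<Longrightarrow> (a, c) \<in> C" for a b c
    using e by (auto simp: equiv_def trans_def)
  show "(a, b) \<in> C \<Longrightarrow> (c, d) \<in> C \<Longrightarrow> (a \<otimes>\<^bsub>S\<^esub> c, b \<otimes>\<^bsub>S\<^esub> d) \<in> C" for a b c d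
    using assms by (simp add: semigroup_congruence_def)
qed

lemma quotient_monoid_mult_classes:
  assumes C: "semigroup_congruence S C" and "a \<in> carrier S" "b \<in> carrier S"
  shows "C `` {a} \<otimes>\<^bsub>quotient_monoid S C\<^esub> C `` {b} = C `` {a \<otimes>\<^bsub>S\<^esub> b}"
proof -
  note cong = semigroup_congruenceD[OF C]
  have "C `` {u \<otimes>\<^bsub>S\<^esub> v} = C `` {a \<otimes>\<^bsub>S\<^esub> b}" if "(a, u) \<in> C" "(b, v) \<in> C" for u v
    using equiv_class_eq[OF cong(1) cong(6)[OF that]] by (rule sym)
  then have "(\<Union>u\<in>C `` {a}. \<Union>v\<in>C `` {b}. C `` {u \<otimes>\<^bsub>S\<^esub> v}) =
      (\<Union>u\<in>C `` {a}. \<Union>v\<in>C `` {b}. C `` {a \<otimes>\<^bsub>S\<^esub> b})"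
    by (intro SUP_cong refl) simp
  also have "\<dots> = C `` {a \<otimes>\<^bsub>S\<^esub> b}"
    using cong(3)[OF assms(2)] cong(3)[OF assms(3)] by blast
  finally show ?thesis
    by (simp add: quotient_monoid_def)
qed

lemma group_congruenceI:
  assumes S: "monoid S" and C: "semigroup_congruence S C"
    and inv: "\<And>a. a \<in> carrier S \<Longrightarrow> \<exists>b \<in> carrier S. (b \<otimes>\<^bsub>S\<^esub> a, \<one>\<^bsub>S\<^esub>) \<in> C"
  shows "group_congruence S C"
proof -
  interpret monoid S by fact
  let ?Q = "quotient_monoid S C"
  note cong = semigroup_congruenceD[OF C]
  have carrierE: "\<exists>a \<in> carrier S. X = C `` {a}" if "X \<in> carrier ?Q" for X
    using that by (auto simp: quotient_monoid_def elim: quotientE)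
  have carrierI: "C `` {a} \<in> carrier ?Q" if "a \<in> carrier S" for a
    using that by (auto simp: quotient_monoid_def intro: quotientI)
  have one: "\<one>\<^bsub>?Q\<^esub> = C `` {\<one>\<^bsub>S\<^esub>}"
    by (simp add: quotient_monoid_def)
  note mult = quotient_monoid_mult_classes[OF C]
  have "group ?Q"
  proof (rule groupI)
    fix X Y assume "X \<in> carrier ?Q" "Y \<in> carrier ?Q"
    then obtain a b where "a \<in> carrier S" "X = C `` {a}" "b \<in> carrier S" "Y = C `` {b}"
      using carrierE by metis
    then show "X \<otimes>\<^bsub>?Q\<^esub> Y \<in> carrier ?Q"
      by (simp add: mult carrierI)
  next
    show "\<one>\<^bsub>?Q\<^esub> \<in> carrier ?Q"
      by (simp add: one carrierI)
  next
    fix X Y Z assume "X \<in> carrier ?Q" "Y \<in> carrier ?Q" "Z \<in> carrier ?Q"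
    then obtain a b c where "a \<in> carrier S" "X = C `` {a}" "b \<in> carrier S" "Y = C `` {b}"
      "c \<in> carrier S" "Z = C `` {c}"
      using carrierE by metis
    then show "X \<otimes>\<^bsub>?Q\<^esub> Y \<otimes>\<^bsub>?Q\<^esub> Z = X \<otimes>\<^bsub>?Q\<^esub> (Y \<otimes>\<^bsub>?Q\<^esub> Z)"
      by (simp add: mult m_assoc)
  next
    fix X assume "X \<in> carrier ?Q"
    then obtain a where a: "a \<in> carrier S" "X = C `` {a}"
      using carrierE by metis
    then show "\<one>\<^bsub>?Q\<^esub> \<otimes>\<^bsub>?Q\<^esub> X = X"
      by (simp add: mult one)
    obtain b where b: "b \<in> carrier S" "(b \<otimes>\<^bsub>S\<^esub> a, \<one>\<^bsub>S\<^esub>) \<in> C"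
      using inv a by metis
    have "C `` {b} \<otimes>\<^bsub>?Q\<^esub> X = \<one>\<^bsub>?Q\<^esub>"
      using a b equiv_class_eq[OF cong(1) b(2)] by (simp add: mult one)
    then show "\<exists>Y \<in> carrier ?Q. Y \<otimes>\<^bsub>?Q\<^esub> X = \<one>\<^bsub>?Q\<^esub>"
      using carrierI b(1) by blast
  qed
  with C show ?thesis
    by (simp add: group_congruence_def)
qed

section \<open>Partial identities and partial inverses\<close>

lemma carrier_cofinite_partial_injections:
  "\<alpha> \<in> carrier (cofinite_partial_injections L) \<longleftrightarrow>
    dom \<alpha> \<subseteq> L \<and> ran \<alpha> \<subseteq> L \<and> inj_on \<alpha> (dom \<alpha>) \<and> finite (L - dom \<alpha>) \<and> finite (L - ran \<alpha>)"
  by (simp add: cofinite_partial_injections_def)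

lemma mult_cofinite_partial_injections:
  "\<alpha> \<otimes>\<^bsub>cofinite_partial_injections L\<^esub> \<beta> = \<beta> \<circ>\<^sub>m \<alpha>"
  by (simp add: cofinite_partial_injections_def)

lemma one_cofinite_partial_injections:
  "\<one>\<^bsub>cofinite_partial_injections L\<^esub> = Some |` L"
  by (simp add: cofinite_partial_injections_def restrict_map_def)

lemma partial_identity_in_carrier:
  assumes "A \<subseteq> L" "finite (L - A)"
  shows "Some |` A \<in> carrier (cofinite_partial_injections L)"
proof -
  have "dom (Some |` A) = A"
    by (simp add: dom_def restrict_map_def)
  moreover have "ran (Some |` A) = A"
    by (auto simp: ran_def restrict_map_def)
  moreover have "inj_on (Some |` A) A"
    by (simp add: inj_on_def)
  ultimately show ?thesis
    using assms by (simp add: carrier_cofinite_partial_injections)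
qed

lemma partial_inverse_exists:
  assumes "\<alpha> \<in> carrier (cofinite_partial_injections L)"
  shows "\<exists>\<beta> \<in> carrier (cofinite_partial_injections L).
    \<beta> \<circ>\<^sub>m \<alpha> = Some |` dom \<alpha> \<and> \<alpha> \<circ>\<^sub>m \<beta> = Some |` ran \<alpha>"
proof -
  have inj: "x = x'" if "\<alpha> x = Some y" "\<alpha> x' = Some y" for x x' y
  proof (rule inj_onD)
    show "inj_on \<alpha> (dom \<alpha>)"
      using assms by (simp add: carrier_cofinite_partial_injections)
    show "\<alpha> x = \<alpha> x'" "x \<in> dom \<alpha>" "x' \<in> dom \<alpha>"
      using that by (simp_all add: domIff)
  qed
  define \<beta> where "\<beta> y = (if y \<in> ran \<alpha> then Some (SOME x. \<alpha> x = Some y) else None)" for y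
  have \<beta>: "\<beta> y = Some x \<longleftrightarrow> \<alpha> x = Some y" for x y
  proof (cases "y \<in> ran \<alpha>")
    case True
    then have "\<exists>x. \<alpha> x = Some y"
      by (simp add: ran_def)
    then have "\<alpha> (SOME x. \<alpha> x = Some y) = Some y"
      by (rule someI_ex)
    then have "(SOME x. \<alpha> x = Some y) = x \<longleftrightarrow> \<alpha> x = Some y"
      using inj by blast
    then show ?thesis
      using True by (simp add: \<beta>_def)
  next
    case False
    then show ?thesis by (auto simp: \<beta>_def ran_def)
  qed
  have "dom \<beta> = ran \<alpha>" "ran \<beta> = dom \<alpha>"
    using \<beta> by (auto simp: dom_def ran_def)
  moreover have "inj_on \<beta> (dom \<beta>)"
  proof (rule inj_onI)
    fix y y' assume "y \<in> dom \<beta>" "\<beta> y = \<beta> y'"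
    then obtain x where "\<beta> y = Some x" "\<beta> y' = Some x" by (metis domD)
    then show "y = y'" by (simp add: \<beta>)
  qed
  ultimately have "\<beta> \<in> carrier (cofinite_partial_injections L)"
    using assms by (auto simp: carrier_cofinite_partial_injections)
  moreover have "(\<beta> \<circ>\<^sub>m \<alpha>) x = (Some |` dom \<alpha>) x" for x
  proof (cases "\<alpha> x")
    case (Some y)
    moreover from this have "\<beta> y = Some x" by (simp add: \<beta>)
    ultimately show ?thesis by (simp add: restrict_map_def domIff)
  qed (simp add: restrict_map_def domIff)
  moreover have "(\<alpha> \<circ>\<^sub>m \<beta>) y = (Some |` ran \<alpha>) y" for y
  proof (cases "\<beta> y")
    case None
    moreover from this have "y \<notin> ran \<alpha>"
      using \<open>dom \<beta> = ran \<alpha>\<close> by (metis domIff)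
    ultimately show ?thesis by (simp add: restrict_map_def)
  next
    case (Some x)
    moreover from this have "\<alpha> x = Some y" by (simp add: \<beta>)
    ultimately show ?thesis by (simp add: restrict_map_def ranI)
  qed
  ultimately show ?thesis by (blast intro: ext)
qed

lemma bij_betw_infinite_Diff_finite:
  assumes "finite F" "infinite A"
  shows "\<exists>h. bij_betw h A (A - F)"
  using assms(1)
proof (induction F rule: finite_induct)
  case empty
  show ?case by (auto intro: bij_betw_id)
next
  case (insert x F)
  then obtain h where "bij_betw h A (A - F)" by blast
  moreover obtain g where "bij_betw g (A - F) (A - F - {x})"
    using infinite_imp_bij_betw[OF Diff_infinite_finite[OF insert.hyps(1) assms(2)]] by blast
  moreover have "A - F - {x} = A - insert x F"
    by blast
  ultimately show ?case
    using bij_betw_trans by metis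
qed

text \<open>Since cofinite subsets of an infinite set are equinumerous with it, prescribing the value at
  one point only amounts to deleting that point and its image.\<close>

lemma bij_betw_cofinite_subset:
  assumes "infinite L" "A \<subseteq> L" "finite (L - A)" "z \<in> L" "x \<in> A"
  shows "\<exists>h. bij_betw h L A \<and> h z = x"
proof -
  have "L - (A - {x}) = insert x (L - A)"
    using assms(2,5) by auto
  then have "finite (L - (A - {x}))"
    using assms(3) by simp
  moreover have "L - (L - (A - {x})) = A - {x}"
    using assms(2) by auto
  ultimately obtain f where f: "bij_betw f L (A - {x})"
    using bij_betw_infinite_Diff_finite[OF _ assms(1)] by metis
  obtain g where g: "bij_betw g L (L - {z})"
    using infinite_imp_bij_betw[OF assms(1)] by blast
  obtain h where h: "bij_betw h (L - {z}) (A - {x})"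
    using bij_betw_trans[OF bij_betw_inv_into[OF g] f] by blast
  have "bij_betw (h(z := x)) (insert z (L - {z})) (insert x (A - {x}))"
  proof -
    have "bij_betw (h(z := x)) (L - {z}) (A - {x})"
      using h by (simp add: bij_betw_def inj_on_def)
    then show ?thesis
      using notIn_Un_bij_betw[of z "L - {z}" "h(z := x)" "A - {x}"] by simp
  qed
  then have "bij_betw (h(z := x)) L A"
    using assms(4,5) by (simp add: insert_absorb)
  then show ?thesis
    by (metis fun_upd_same)
qed

section \<open>Identifying the idempotents with the unit\<close>

lemma point_deletion_congruent_one:
  fixes L :: "'a set"
  assumes L: "infinite L" and C: "semigroup_congruence (cofinite_partial_injections L) C"
    and ab: "(\<alpha>, \<beta>) \<in> C" and x: "x \<in> dom \<alpha>" "x \<notin> dom \<beta>" and z: "z \<in> L"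
  shows "(Some |` (L - {z}), Some |` L) \<in> C"
proof -
  let ?S = "cofinite_partial_injections L"
  interpret monoid ?S by (rule monoid_cofinite_partial_injections)
  note cong = semigroup_congruenceD[OF C]
  note mult = mult_cofinite_partial_injections
  have \<alpha>: "\<alpha> \<in> carrier ?S"
    using cong(2) ab by blast
  obtain h where h: "bij_betw h L (dom \<alpha>)" "h z = x"
    using bij_betw_cofinite_subset[OF L _ _ z x(1)] \<alpha>
    by (auto simp: carrier_cofinite_partial_injections)
  define \<sigma> where "\<sigma> y = (if y \<in> L then Some (h y) else None)" for y
  have "dom \<sigma> = L"
    by (auto simp: \<sigma>_def dom_def)
  moreover have "ran \<sigma> = h ` L"
    by (auto simp: \<sigma>_def ran_def)
  then have "ran \<sigma> = dom \<alpha>"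
    using h(1) by (simp add: bij_betw_def)
  moreover have "inj_on \<sigma> (dom \<sigma>)"
    using h by (auto simp: \<sigma>_def inj_on_def dom_def bij_betw_def split: if_splits)
  ultimately have \<sigma>: "\<sigma> \<in> carrier ?S"
    using \<alpha> by (auto simp: carrier_cofinite_partial_injections)
  have "dom (\<alpha> \<circ>\<^sub>m \<sigma>) = L"
  proof -
    have "h y \<in> dom \<alpha>" if "y \<in> L" for y
      using h that by (auto simp: bij_betw_def)
    then show ?thesis
      by (force simp: \<sigma>_def map_comp_def dom_def)
  qed
  moreover have "\<alpha> \<circ>\<^sub>m \<sigma> \<in> carrier ?S"
    using m_closed[OF \<sigma> \<alpha>] by (simp add: mult)
  ultimately obtain \<tau> where \<tau>: "\<tau> \<in> carrier ?S" "\<tau> \<circ>\<^sub>m (\<alpha> \<circ>\<^sub>m \<sigma>) = Some |` L"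
    using partial_inverse_exists by metis
  define \<gamma> where "\<gamma> = \<tau> \<circ>\<^sub>m (\<beta> \<circ>\<^sub>m \<sigma>)"
  have one_\<gamma>: "(Some |` L, \<gamma>) \<in> C"
    using cong(6)[OF cong(6)[OF cong(3)[OF \<sigma>] ab] cong(3)[OF \<tau>(1)]] \<tau>(2)
    by (simp add: \<gamma>_def mult)
  have "\<gamma> z = None"
    using x(2) h(2) z by (simp add: \<gamma>_def \<sigma>_def domIff)
  moreover have "dom \<gamma> \<subseteq> L"
    using cong(2)[OF one_\<gamma>] by (simp add: carrier_cofinite_partial_injections)
  then have "\<gamma> y = None" if "y \<notin> L" for y
    using that by (meson domIff subsetD)
  ultimately have absorb: "\<gamma> \<circ>\<^sub>m (Some |` (L - {z})) = \<gamma>"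
    by (auto simp: fun_eq_iff map_comp_def restrict_map_def)
  have \<epsilon>: "Some |` (L - {z}) \<in> carrier ?S"
    by (rule partial_identity_in_carrier) (auto intro: finite_subset[of _ "{z}"])
  have "(Some |` (L - {z}) \<otimes>\<^bsub>?S\<^esub> \<one>\<^bsub>?S\<^esub>, Some |` (L - {z}) \<otimes>\<^bsub>?S\<^esub> \<gamma>) \<in> C"
    using cong(6)[OF cong(3)[OF \<epsilon>] one_\<gamma>] by (simp add: one_cofinite_partial_injections)
  then have "(Some |` (L - {z}), \<gamma>) \<in> C"
    using r_one[OF \<epsilon>] absorb by (simp add: mult)
  then show ?thesis
    using one_\<gamma> cong(4,5) by blast
qed

lemma cofinite_partial_identity_congruent_one:
  assumes C: "semigroup_congruence (cofinite_partial_injections L) C"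
    and del: "\<And>z. z \<in> L \<Longrightarrow> (Some |` (L - {z}), Some |` L) \<in> C"
    and A: "A \<subseteq> L" "finite (L - A)"
  shows "(Some |` A, Some |` L) \<in> C"
proof -
  let ?S = "cofinite_partial_injections L"
  interpret monoid ?S by (rule monoid_cofinite_partial_injections)
  note cong = semigroup_congruenceD[OF C]
  have "(Some |` (L - F), Some |` L) \<in> C" if "finite F" "F \<subseteq> L" for F
    using that
  proof (induction F rule: finite_induct)
    case empty
    show ?case
      using cong(3)[OF one_closed] by (simp add: one_cofinite_partial_injections)
  next
    case (insert z F)
    have "Some |` (L - {z}) \<otimes>\<^bsub>?S\<^esub> Some |` (L - F) = Some |` (L - insert z F)"
      by (auto simp: mult_cofinite_partial_injections fun_eq_iff map_comp_def restrict_map_def)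
    moreover have "Some |` L \<otimes>\<^bsub>?S\<^esub> Some |` L = Some |` L"
      using r_one[OF one_closed] by (simp add: one_cofinite_partial_injections)
    ultimately show ?case
      using cong(6)[OF del[of z] insert.IH] insert.prems by simp
  qed
  from this[OF A(2)] show ?thesis
    using A(1) by (simp add: double_diff)
qed

text \<open>If both elements are defined at a point \<open>x\<close> but take different values there, deleting the
  value of one of them from the codomain removes \<open>x\<close> from the domain of that one only.\<close>

lemma congruent_pair_with_distinct_domains:
  assumes C: "semigroup_congruence (cofinite_partial_injections L) C"
    and ab: "(\<alpha>, \<beta>) \<in> C" "\<alpha> \<noteq> \<beta>"
  shows "\<exists>\<alpha>' \<beta>' x. (\<alpha>', \<beta>') \<in> C \<and> x \<in> dom \<alpha>' \<and> x \<notin> dom \<beta>'"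
proof -
  let ?S = "cofinite_partial_injections L"
  note cong = semigroup_congruenceD[OF C]
  obtain x where x: "\<alpha> x \<noteq> \<beta> x"
    using ab(2) by auto
  consider "\<alpha> x = None" "x \<in> dom \<beta>" | "\<beta> x = None" "x \<in> dom \<alpha>"
    | u v where "\<alpha> x = Some u" "\<beta> x = Some v" "u \<noteq> v"
    using x by (cases "\<alpha> x"; cases "\<beta> x") auto
  then show ?thesis
  proof cases
    case 1
    then show ?thesis using cong(4)[OF ab(1)] by blast
  next
    case 2
    then show ?thesis using ab(1) by blast
  next
    case 3
    let ?\<epsilon> = "Some |` (L - {v})"
    have "?\<epsilon> \<in> carrier ?S"
      by (rule partial_identity_in_carrier) (auto intro: finite_subset[of _ "{v}"])
    then have "(?\<epsilon> \<circ>\<^sub>m \<alpha>, ?\<epsilon> \<circ>\<^sub>m \<beta>) \<in> C"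
      using cong(6)[OF ab(1) cong(3)] by (simp add: mult_cofinite_partial_injections)
    moreover have "u \<in> L"
      using cong(2)[OF ab(1)] 3(1) by (auto simp: carrier_cofinite_partial_injections intro: ranI)
    then have "x \<in> dom (?\<epsilon> \<circ>\<^sub>m \<alpha>)" "x \<notin> dom (?\<epsilon> \<circ>\<^sub>m \<beta>)"
      using 3 by (simp_all add: domIff)
    ultimately show ?thesis by blast
  qed
qed

theorem theorem2p7:
  fixes L :: "'a set" and C :: "(('a \<rightharpoonup> 'a) \<times> ('a \<rightharpoonup> 'a)) set"
  assumes "infinite L"
    and "nontrivial_congruence (cofinite_partial_injections L) C"
  shows "group_congruence (cofinite_partial_injections L) C"
proof -
  let ?S = "cofinite_partial_injections L"
  have C: "semigroup_congruence ?S C" and "C \<noteq> Id_on (carrier ?S)"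
    using assms(2) by (auto simp: nontrivial_congruence_def)
  note cong = semigroup_congruenceD[OF C]
  have "\<exists>\<alpha> \<beta>. (\<alpha>, \<beta>) \<in> C \<and> \<alpha> \<noteq> \<beta>"
  proof (rule ccontr)
    assume "\<nexists>\<alpha> \<beta>. (\<alpha>, \<beta>) \<in> C \<and> \<alpha> \<noteq> \<beta>"
    then have "(\<alpha>, \<beta>) \<in> C \<longleftrightarrow> (\<alpha>, \<beta>) \<in> Id_on (carrier ?S)" for \<alpha> \<beta>
      using cong(2)[of \<alpha> \<beta>] cong(3)[of \<alpha>] unfolding Id_on_iff by blast
    then have "C = Id_on (carrier ?S)"
      unfolding set_eq_iff split_paired_All by blast
    with \<open>C \<noteq> Id_on (carrier ?S)\<close> show False ..
  qed
  then obtain \<alpha> \<beta> where \<alpha>\<beta>: "(\<alpha>, \<beta>) \<in> C" "\<alpha> \<noteq> \<beta>"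
    by blast
  obtain \<alpha>' \<beta>' x where distinct: "(\<alpha>', \<beta>') \<in> C" "x \<in> dom \<alpha>'" "x \<notin> dom \<beta>'"
    using congruent_pair_with_distinct_domains[OF C \<alpha>\<beta>] by blast
  note deletion = point_deletion_congruent_one[OF assms(1) C distinct]
  have idem: "(Some |` A, \<one>\<^bsub>?S\<^esub>) \<in> C" if "A \<subseteq> L" "finite (L - A)" for A
    unfolding one_cofinite_partial_injections
    using deletion that by (rule cofinite_partial_identity_congruent_one[OF C])
  show ?thesis
  proof (rule group_congruenceI[OF monoid_cofinite_partial_injections C])
    fix \<alpha> assume \<alpha>: "\<alpha> \<in> carrier ?S"
    obtain \<beta> where \<beta>: "\<beta> \<in> carrier ?S" "\<beta> \<otimes>\<^bsub>?S\<^esub> \<alpha> = Some |` ran \<alpha>"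
      using partial_inverse_exists[OF \<alpha>] unfolding mult_cofinite_partial_injections by blast
    have "(Some |` ran \<alpha>, \<one>\<^bsub>?S\<^esub>) \<in> C"
      using \<alpha> idem by (simp add: carrier_cofinite_partial_injections)
    then show "\<exists>\<beta> \<in> carrier ?S. (\<beta> \<otimes>\<^bsub>?S\<^esub> \<alpha>, \<one>\<^bsub>?S\<^esub>) \<in> C"
      using \<beta>(1) unfolding \<beta>(2)[symmetric] by (rule bexI)
  qed
qed

end
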